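(* Let $n\geq 3$. There exists $\gamma_n\in(0,1)$, depending only on $n$, such that for any fixed $c_n\in(0,\gamma_n]$ there is a constant $C>0$, depending only on $n$ and $c_n$, with the following property. Let $1\leq k\leq n$ and $0<\delta\leq 1/2$. Let $t_1,t_2\in[-1,1]$, let $x_j := t_j d_k$ for $j=1,2$, and let $\mathbf{r}_1,\mathbf{r}_2\in [1,1+c_n^2]^n$. Then $$\big|E^{\delta,k}(x_1,\mathbf{r}_1)\cap E^{\delta,k}(x_2,\mathbf{r}_2)\big| \leq C\,(\log \delta^{-1})\,\frac{\delta^2}{\delta+|t_1-t_2|}.$$
   Context: $|\cdot|$ applied to a set is Lebesgue measure on $\mathbb{R}^n$. For $x\in\mathbb{R}^n$, $\mathbf{r}=(r_1,\dots,r_n)\in(0,\infty)^n$ and $\delta>0$ let $$F_{x,\mathbf{r}}(y) := \sum_{j=1}^n \frac{(y_j-x_j)^2}{r_j^2}-1, \qquad E^{\delta}(x,\mathbf{r}) := \{y\in\mathbb{R}^n : |F_{x,\mathbf{r}}(y)|<\delta\}.$$ Let $A_{x,\mathbf{r}}\colon\mathbb{R}^n\to\mathbb{R}^n$ be the affine map $A_{x,\mathbf{r}}(\omega) := x + (r_1\omega_1,\dots,r_n\omega_n)$. For $1\leq k\leq n$ let $\Omega^k := \{\omega\in\mathbb{R}^n : |\omega_k|^3\geq 2c_n\}$ and $$E^{\delta,k}(x,\mathbf{r}) := E^{\delta}(x,\mathbf{r})\cap A_{x,\mathbf{r}}(\Omega^k).$$ Let $d_k=(d_{k,1},\dots,d_{k,n})\in\mathbb{R}^n$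 be the vector with $d_{k,j}=1$ if $j\neq k$ and $d_{k,k}=0$. *)

theory Defs
  imports "HOL-Analysis.Analysis"
begin

definition ell_fun :: "real ^ 'n \<Rightarrow> real ^ 'n \<Rightarrow> real ^ 'n \<Rightarrow> real" where
  "ell_fun x r y = (\<Sum>j\<in>UNIV. (y $ j - x $ j)\<^sup>2 / (r $ j)\<^sup>2) - 1"

definition ell_nbhd :: "real \<Rightarrow> real ^ 'n \<Rightarrow> real ^ 'n \<Rightarrow> (real ^ 'n) set" where
  "ell_nbhd \<delta> x r = {y. \<bar>ell_fun x r y\<bar> < \<delta>}"

definition ell_map :: "real ^ 'n \<Rightarrow> real ^ 'n \<Rightarrow> real ^ 'n \<Rightarrow> real ^ 'n" where
  "ell_map x r \<omega> = x + (\<chi> j. r $ j * \<omega> $ j)"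

definition Omega_set :: "real \<Rightarrow> 'n \<Rightarrow> (real ^ 'n) set" where
  "Omega_set c k = {\<omega>. \<bar>\<omega> $ k\<bar> ^ 3 \<ge> 2 * c}"

text \<open>The parameter \<open>c\<close> is the constant \<open>c\<^sub>n\<close>, which is left implicit in the usual notation
  \<open>E\<^sup>\<delta>\<^sup>,\<^sup>k(x, r)\<close>.\<close>

definition ell_nbhd_part ::
    "real \<Rightarrow> real \<Rightarrow> 'n \<Rightarrow> real ^ 'n \<Rightarrow> real ^ 'n \<Rightarrow> (real ^ 'n) set" where
  "ell_nbhd_part c \<delta> k x r = ell_nbhd \<delta> x r \<inter> ell_map x r ` Omega_set c k"

definition dir_vec :: "'n \<Rightarrow> real ^ 'n" where
  "dir_vec k = (\<chi> j. if j = k then 0 else 1)"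

end

theory Submission
  imports Defs
begin

text \<open>Write \<open>F\<^sub>1\<close>, \<open>F\<^sub>2\<close> for the two quadratic functions and \<open>a = r\<^sub>1\<^sup>2\<close>, \<open>b = r\<^sub>2\<^sup>2\<close> coordinatewise. On the
  intersection \<open>\<bar>y\<^sub>k\<bar>\<close> is bounded below by a constant \<open>\<kappa>\<close>, so with the other coordinates fixed
  \<open>y\<^sub>k\<close> ranges over a set of length \<open>O(\<delta>)\<close>. The combination \<open>\<mu> F\<^sub>1 - F\<^sub>2\<close> with \<open>\<mu> = a\<^sub>k / b\<^sub>k\<close> does not
  involve \<open>y\<^sub>k\<close>; it is a sum of one-variable quadratics in the remaining coordinates with leading coefficients
  \<open>A\<^sub>l = \<mu> / a\<^sub>l - 1 / b\<^sub>l\<close>, and it is \<open>O(\<delta>)\<close> on the intersection. If some \<open>\<bar>A\<^sub>l\<bar>\<close> is small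
  compared with \<open>\<tau> = \<bar>t\<^sub>1 - t\<^sub>2\<bar>\<close>, then the \<open>l\<close>-th quadratic has slope of order \<open>\<tau>\<close> and \<open>y\<^sub>l\<close> ranges over a
  set of length \<open>O(\<delta> / \<tau>)\<close>. Otherwise two of the coordinates enter through
  \<open>A (u - m)\<^sup>2 + B (v - n)\<^sup>2\<close> with \<open>\<bar>A\<bar>\<close>, \<open>\<bar>B\<bar>\<close> at least of order \<open>\<tau>\<close>, and the sublevel sets of such a
  function, possibly a saddle, have area \<open>O(\<delta> log(1/\<delta>) / \<tau>)\<close>.\<close>

section \<open>Lengths of sublevel sets of one-variable quadratics\<close>

lemma nn_integral_indicator_le_diameter:
  fixes S :: "real set"
  assumes "0 \<le> d" "\<And>x y. x \<in> S \<Longrightarrow> y \<in> S \<Longrightarrow> \<bar>x - y\<bar> \<le> d"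
  shows "(\<integral>\<^sup>+x. indicator S x \<partial>lborel) \<le> ennreal (2 * d)"
proof (cases "S = {}")
  case False
  then obtain x where x: "x \<in> S" by blast
  have "S \<subseteq> {x - d..x + d}" using assms(2)[OF x] by (fastforce simp: abs_le_iff)
  then have "(\<integral>\<^sup>+x. indicator S x \<partial>lborel) \<le> (\<integral>\<^sup>+y. indicator {x - d..x + d} y \<partial>lborel)"
    by (intro nn_integral_mono) (auto split: split_indicator)
  then show ?thesis using assms(1) by (simp add: algebra_simps)
qed simp

text \<open>The set where a quadratic with vertex \<open>m\<close> is close to a given value can
  have two pieces, one on each side of \<open>m\<close>. Its diameter then says nothing, but each
  side alone has small diameter. Covering each side by an interval of length \<open>2 * d\<close>
  gives the factor 4.\<close>

lemma nn_integral_indicator_le_diameter_signed: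
  fixes S :: "real set"
  assumes "0 \<le> d" "\<And>x y. x \<in> S \<Longrightarrow> y \<in> S \<Longrightarrow> 0 \<le> (x - m) * (y - m) \<Longrightarrow> \<bar>x - y\<bar> \<le> d"
  shows "(\<integral>\<^sup>+x. indicator S x \<partial>lborel) \<le> ennreal (4 * d)"
proof -
  have *: "\<exists>x. S \<inter> A \<subseteq> {x - d..x + d}" if "\<And>x y. x \<in> A \<Longrightarrow> y \<in> A \<Longrightarrow> 0 \<le> (x - m) * (y - m)" for A
  proof (cases "S \<inter> A = {}")
    case False
    then obtain x where x: "x \<in> S \<inter> A" by blast
    have "\<bar>x - y\<bar> \<le> d" if "y \<in> S \<inter> A" for y
      using x that by (intro assms(2) \<open>\<And>x y. x \<in> A \<Longrightarrow> y \<in> A \<Longrightarrow> 0 \<le> (x - m) * (y - m)\<close>) auto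
    then show ?thesis by (intro exI[of _ x]) (fastforce simp: abs_le_iff)
  qed auto
  obtain a where a: "S \<inter> {m..} \<subseteq> {a - d..a + d}" using *[of "{m..}"] by auto
  obtain b where b: "S \<inter> {..m} \<subseteq> {b - d..b + d}"
    using *[of "{..m}"] mult_nonpos_nonpos[of "_ - m" "_ - m"] by auto
  have "S \<subseteq> {a - d..a + d} \<union> {b - d..b + d}"
  proof
    fix x assume "x \<in> S" then show "x \<in> {a - d..a + d} \<union> {b - d..b + d}"
      using a b by (cases "m \<le> x") (auto simp del: atLeastAtMost_iff)
  qed
  then have "(\<integral>\<^sup>+x. indicator S x \<partial>lborel)
      \<le> (\<integral>\<^sup>+x. indicator ({a - d..a + d} \<union> {b - d..b + d}) x \<partial>lborel)"
    by (intro nn_integral_mono) (auto split: split_indicator)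
  also have "\<dots> = emeasure lborel ({a - d..a + d} \<union> {b - d..b + d})" by simp
  also have "\<dots> \<le> emeasure lborel {a - d..a + d} + emeasure lborel {b - d..b + d}"
    by (intro emeasure_subadditive) auto
  also have "\<dots> = ennreal (4 * d)"
    using assms(1) by (simp flip: ennreal_plus)
  finally show ?thesis .
qed

text \<open>For equal signs there is no cancellation in \<open>x + y\<close>, so
  \<open>\<bar>x - y\<bar> \<le> \<bar>x + y\<bar>\<close>, and a bound on the difference of
  squares, which factors as \<open>(x - y) * (x + y)\<close>, yields one on
  \<open>x - y\<close>.\<close>

lemma same_sign_diff_le:
  fixes x y :: real
  assumes "0 \<le> x * y"
  shows "(x - y)\<^sup>2 \<le> \<bar>x\<^sup>2 - y\<^sup>2\<bar>" "x\<^sup>2 + y\<^sup>2 \<le> (x + y)\<^sup>2" "\<bar>x + y\<bar> = \<bar>x\<bar> + \<bar>y\<bar>"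
proof -
  show 1: "\<bar>x + y\<bar> = \<bar>x\<bar> + \<bar>y\<bar>" using assms by (auto simp: zero_le_mult_iff)
  show "x\<^sup>2 + y\<^sup>2 \<le> (x + y)\<^sup>2" using assms by (simp add: power2_sum)
  have "\<bar>x - y\<bar> * \<bar>x - y\<bar> \<le> \<bar>x - y\<bar> * \<bar>x + y\<bar>" unfolding 1 by (intro mult_left_mono) auto
  then show "(x - y)\<^sup>2 \<le> \<bar>x\<^sup>2 - y\<^sup>2\<bar>"
    by (simp add: power2_eq_square square_diff_square_factored abs_mult[symmetric] mult.commute)
qed

text \<open>Two regimes are merged by \<open>max h \<bar>E\<bar>\<close>. For \<open>E\<close> of
  size at most about \<open>h\<close> the set lies near the vertex and has length of order
  \<open>sqrt (h / \<bar>A\<bar>)\<close>. For larger \<open>E\<close> its points are at distance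
  about \<open>sqrt (\<bar>E\<bar> / \<bar>A\<bar>)\<close> from \<open>m\<close>, where the slope
  is of order \<open>sqrt (\<bar>A\<bar> * \<bar>E\<bar>)\<close>.\<close>

lemma quadratic_sublevel:
  fixes A E h m :: real
  assumes "A \<noteq> 0" "0 < h"
  shows "(\<integral>\<^sup>+u. indicator {u. \<bar>A * (u - m)\<^sup>2 - E\<bar> \<le> h} u \<partial>lborel)
    \<le> ennreal (12 * h / sqrt (\<bar>A\<bar> * max h \<bar>E\<bar>))"
proof -
  define d where "d = 3 * h / sqrt (\<bar>A\<bar> * max h \<bar>E\<bar>)"
  have pos: "0 < \<bar>A\<bar> * max h \<bar>E\<bar>" using assms by (intro mult_pos_pos) auto
  have "\<bar>x - y\<bar> \<le> d" if "\<bar>A * (x - m)\<^sup>2 - E\<bar> \<le> h" "\<bar>A * (y - m)\<^sup>2 - E\<bar> \<le> h"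
    and s: "0 \<le> (x - m) * (y - m)" for x y
  proof -
    define X Y where "X = x - m" and "Y = y - m"
    have XY: "\<bar>A * X\<^sup>2 - E\<bar> \<le> h" "\<bar>A * Y\<^sup>2 - E\<bar> \<le> h" using that by (auto simp: X_def Y_def)
    note sg = same_sign_diff_le[OF s, folded X_def Y_def]
    have AX: "\<bar>A\<bar> * X\<^sup>2 = \<bar>A * X\<^sup>2\<bar>" "\<bar>A\<bar> * Y\<^sup>2 = \<bar>A * Y\<^sup>2\<bar>" by (auto simp: abs_mult)
    have dif: "\<bar>A\<bar> * \<bar>X\<^sup>2 - Y\<^sup>2\<bar> \<le> 2 * h"
      using XY by (simp add: abs_mult[symmetric] right_diff_distrib)
    have "\<bar>A\<bar> * max h \<bar>E\<bar> * (X - Y)\<^sup>2 \<le> (3 * h)\<^sup>2"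
    proof (cases "\<bar>E\<bar> \<le> 2 * h")
      case True
      have "\<bar>A\<bar> * (X - Y)\<^sup>2 \<le> \<bar>A\<bar> * \<bar>X\<^sup>2 - Y\<^sup>2\<bar>" using sg(1) by (intro mult_left_mono) auto
      then have "\<bar>A\<bar> * (X - Y)\<^sup>2 \<le> 2 * h" using dif by linarith
      then have "max h \<bar>E\<bar> * (\<bar>A\<bar> * (X - Y)\<^sup>2) \<le> (2 * h) * (2 * h)"
        using True assms by (intro mult_mono[of _ "2 * h" _ "2 * h"]) auto
      also have "\<dots> \<le> (3 * h)\<^sup>2" by (simp add: power2_eq_square)
      finally show ?thesis by (simp add: mult_ac)
    next
      case False
      \<comment> \<open>Away from the vertex \<open>\<bar>A\<bar> * X\<^sup>2\<close> and
        \<open>\<bar>A\<bar> * Y\<^sup>2\<close> are each at least \<open>\<bar>E\<bar> - h\<close>,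
        hence at least half of \<open>\<bar>E\<bar>\<close>. This bounds \<open>X + Y\<close> from
        below, and multiplying by \<open>(X - Y)\<^sup>2\<close> leads back to
        \<open>dif\<close>.\<close>
      have "\<bar>E\<bar> \<le> \<bar>A\<bar> * (X\<^sup>2 + Y\<^sup>2)"
        unfolding distrib_left AX using XY False by linarith
      also have "\<dots> \<le> \<bar>A\<bar> * (X + Y)\<^sup>2" using sg(2) by (intro mult_left_mono) auto
      finally have "\<bar>E\<bar> * (\<bar>A\<bar> * (X - Y)\<^sup>2) \<le> (\<bar>A\<bar> * (X + Y)\<^sup>2) * (\<bar>A\<bar> * (X - Y)\<^sup>2)"
        by (intro mult_right_mono) auto
      also have "\<dots> = (\<bar>A\<bar> * \<bar>X\<^sup>2 - Y\<^sup>2\<bar>)\<^sup>2"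
        by (simp add: power_mult_distrib power2_eq_square algebra_simps)
      also have "\<dots> \<le> (2 * h)\<^sup>2" using dif assms by (intro power_mono) auto
      also have "\<dots> \<le> (3 * h)\<^sup>2" by (simp add: power2_eq_square)
      finally show ?thesis using False assms by (simp add: mult_ac max_def)
    qed
    then have "sqrt (\<bar>A\<bar> * max h \<bar>E\<bar> * (X - Y)\<^sup>2) \<le> 3 * h"
      using assms by (intro real_le_lsqrt) auto
    then have "sqrt (\<bar>A\<bar> * max h \<bar>E\<bar>) * \<bar>x - y\<bar> \<le> 3 * h"
      by (simp add: real_sqrt_mult X_def Y_def)
    then show ?thesis using pos by (simp add: d_def pos_le_divide_eq mult.commute)
  qed
  moreover have "0 \<le> d" using assms by (simp add: d_def)
  ultimately have "(\<integral>\<^sup>+u. indicator {u. \<bar>A * (u - m)\<^sup>2 - E\<bar> \<le> h} u \<partial>lborel) \<le> ennreal (4 * d)"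
    by (intro nn_integral_indicator_le_diameter_signed) auto
  then show ?thesis by (simp add: d_def)
qed

text \<open>The logarithm of the final estimate originates here: the integrand is 1 over the
  distance to \<open>c\<close>, cut off at scale \<open>\<rho>\<close>, and its antiderivative is an
  \<open>arsinh\<close>.\<close>

lemma nn_integral_inverse_sqrt_le:
  fixes l h c \<rho> :: real
  assumes "l \<le> h" "0 < \<rho>"
  shows "(\<integral>\<^sup>+v. ennreal (1 / sqrt (\<rho>\<^sup>2 + (v - c)\<^sup>2)) * indicator {l..h} v \<partial>lborel)
    \<le> ennreal (2 * arsinh ((h - l) / \<rho>))"
proof -
  \<comment> \<open>Moving the center into the interval only increases the integrand, and gives a bound independent of \<open>c\<close>.\<close>
  define c' where "c' = max l (min h c)"
  have pos: "0 < \<rho>\<^sup>2 + x\<^sup>2" for x using assms by (simp add: sum_power2_gt_zero_iff)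
  have le: "1 / sqrt (\<rho>\<^sup>2 + (v - c)\<^sup>2) \<le> 1 / sqrt (\<rho>\<^sup>2 + (v - c')\<^sup>2)" if "v \<in> {l..h}" for v
  proof -
    have "\<bar>v - c'\<bar> \<le> \<bar>v - c\<bar>" using that by (auto simp: c'_def)
    then have "(v - c')\<^sup>2 \<le> (v - c)\<^sup>2" by (simp add: abs_le_square_iff)
    then show ?thesis using pos by (intro divide_left_mono) auto
  qed
  have "(\<integral>\<^sup>+v. ennreal (1 / sqrt (\<rho>\<^sup>2 + (v - c)\<^sup>2)) * indicator {l..h} v \<partial>lborel)
    \<le> (\<integral>\<^sup>+v. ennreal (1 / sqrt (\<rho>\<^sup>2 + (v - c')\<^sup>2)) * indicator {l..h} v \<partial>lborel)"
    using le by (intro nn_integral_mono) (auto split: split_indicator intro!: ennreal_leI)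
  also have "\<dots> = ennreal (arsinh ((h - c') / \<rho>) - arsinh ((l - c') / \<rho>))"
  proof (rule nn_integral_FTC_Icc)
    fix v :: real
    have "sqrt (\<rho>\<^sup>2 + (v - c')\<^sup>2) = sqrt (\<rho>\<^sup>2 * (((v - c') / \<rho>)\<^sup>2 + 1))"
      using assms by (simp add: field_simps power2_eq_square)
    also have "\<dots> = \<rho> * sqrt (((v - c') / \<rho>)\<^sup>2 + 1)" using assms by (simp add: real_sqrt_mult)
    finally have eq: "sqrt (\<rho>\<^sup>2 + (v - c')\<^sup>2) = \<rho> * sqrt (((v - c') / \<rho>)\<^sup>2 + 1)" .
    have "((\<lambda>v. (v - c') / \<rho>) has_real_derivative 1 / \<rho>) (at v)"
      using assms by (auto intro!: derivative_eq_intros)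
    from DERIV_chain2[OF arsinh_real_has_field_derivative this]
    show "((\<lambda>v. arsinh ((v - c') / \<rho>)) has_real_derivative 1 / sqrt (\<rho>\<^sup>2 + (v - c')\<^sup>2)) (at v)"
      unfolding eq by (simp add: mult.commute)
  qed (use assms pos in auto)
  also have "\<dots> \<le> ennreal (2 * arsinh ((h - l) / \<rho>))"
  proof -
    have mono: "arsinh x \<le> arsinh y" if "x \<le> y" for x y :: real
      using that by (meson arsinh_less_iff_real not_less)
    have "arsinh ((h - c') / \<rho>) \<le> arsinh ((h - l) / \<rho>)"
      using assms by (intro mono divide_right_mono) (auto simp: c'_def)
    moreover have "arsinh (- ((l - c') / \<rho>)) \<le> arsinh ((h - l) / \<rho>)"
      using assms unfolding minus_divide_left
      by (intro mono divide_right_mono) (auto simp: c'_def)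
    ultimately show ?thesis unfolding arsinh_minus_real by (intro ennreal_leI) linarith
  qed
  finally show ?thesis .
qed

section \<open>Slicing Lebesgue measure along three coordinates\<close>

lemma emeasure_lborel_le_three_sections:
  fixes T :: "'a::euclidean_space set" and B :: ennreal
  assumes T: "T \<in> sets borel" and box: "\<And>x b. x \<in> T \<Longrightarrow> b \<in> Basis \<Longrightarrow> \<bar>x \<bullet> b\<bar> \<le> R" and R: "0 \<le> R"
    and ijk: "i \<in> Basis" "j \<in> Basis" "k \<in> Basis" "i \<noteq> j" "i \<noteq> k" "j \<noteq> k"
    and sect: "\<And>x. x \<bullet> i = 0 \<Longrightarrow> x \<bullet> j = 0 \<Longrightarrow> x \<bullet> k = 0 \<Longrightarrow>
      (\<integral>\<^sup>+v. \<integral>\<^sup>+u. \<integral>\<^sup>+s. indicator T (x + v *\<^sub>R j + u *\<^sub>R i + s *\<^sub>R k) \<partial>lborel \<partial>lborel \<partial>lborel) \<le> B"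
  shows "emeasure lborel T \<le> B * ennreal ((2 * R) ^ (DIM('a) - 3))"
proof -
  interpret product_sigma_finite "\<lambda>_::'a. lborel :: real measure" ..
  define K where "K = Basis - {i, j, k}"
  define V :: "('a \<Rightarrow> real) \<Rightarrow> 'a" where "V = (\<lambda>f. \<Sum>b\<in>Basis. f b *\<^sub>R b)"
  have K: "finite K" "Basis = insert k (insert i (insert j K))" "k \<notin> insert i (insert j K)"
    "i \<notin> insert j K" "j \<notin> K" using ijk by (auto simp: K_def)
  have V[measurable]: "V \<in> measurable (\<Pi>\<^sub>M b\<in>Basis. lborel) borel"
    unfolding V_def by measurable
  have Vup: "V (f(j := v, i := u, k := s)) = (\<Sum>b\<in>K. f b *\<^sub>R b) + v *\<^sub>R j + u *\<^sub>R i + s *\<^sub>R k" for f v u s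
  proof -
    have "(\<Sum>b\<in>K. (f(j := v, i := u, k := s)) b *\<^sub>R b) = (\<Sum>b\<in>K. f b *\<^sub>R b)"
      using K by (intro sum.cong) auto
    then show ?thesis unfolding V_def K(2) using K(1,3,4,5) ijk by (simp add: add_ac)
  qed
  have ind: "(\<lambda>f. indicator T (V f) :: ennreal) \<in> borel_measurable (\<Pi>\<^sub>M b\<in>Basis. lborel)"
    using T by measurable
  have ind1: "(\<lambda>f. \<integral>\<^sup>+s. indicator T (V (f(k := s))) \<partial>lborel) \<in> borel_measurable (Pi\<^sub>M (insert i (insert j K)) (\<lambda>_. lborel))"
    using ind unfolding K(2)  by measurable
  have ind2: "(\<lambda>f. \<integral>\<^sup>+u. \<integral>\<^sup>+s. indicator T (V (f(i := u, k := s))) \<partial>lborel \<partial>lborel) \<in> borel_measurable (Pi\<^sub>M (insert j K) (\<lambda>_. lborel))"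
    using ind1 by measurable
  have "emeasure lborel T = (\<integral>\<^sup>+f. indicator T (V f) \<partial>(\<Pi>\<^sub>M b\<in>Basis. lborel))"
  proof -
    have "emeasure lborel T = (\<integral>\<^sup>+x. indicator T x \<partial>distr (\<Pi>\<^sub>M b\<in>Basis. lborel) borel V)"
      using T unfolding V_def lborel_eq[symmetric] by simp
    then show ?thesis using T by (subst (asm) nn_integral_distr) auto
  qed
  also have "\<dots> = (\<integral>\<^sup>+f. \<integral>\<^sup>+s. indicator T (V (f(k := s))) \<partial>lborel \<partial>(\<Pi>\<^sub>M b\<in>insert i (insert j K). lborel))"
    using K ind unfolding K(2) by (intro product_nn_integral_insert) auto
  also have "\<dots> = (\<integral>\<^sup>+f. \<integral>\<^sup>+u. \<integral>\<^sup>+s. indicator T (V (f(i := u, k := s))) \<partial>lborel \<partial>lborel \<partial>(\<Pi>\<^sub>M b\<in>insert j K. lborel))"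
    using K ind1 by (intro product_nn_integral_insert) auto
  also have "\<dots> = (\<integral>\<^sup>+f. \<integral>\<^sup>+v. \<integral>\<^sup>+u. \<integral>\<^sup>+s. indicator T (V (f(j := v, i := u, k := s)))
      \<partial>lborel \<partial>lborel \<partial>lborel \<partial>(\<Pi>\<^sub>M b\<in>K. lborel))"
    using K ind2 by (intro product_nn_integral_insert) auto
  also have "\<dots> \<le> (\<integral>\<^sup>+f. B * indicator (\<Pi>\<^sub>E b\<in>K. {-R..R}) f \<partial>(\<Pi>\<^sub>M b\<in>K. lborel))"
  proof (rule nn_integral_mono)
    fix f assume f: "f \<in> space (\<Pi>\<^sub>M b\<in>K. (lborel :: real measure))"
    define x where "x = (\<Sum>b\<in>K. f b *\<^sub>R b)"
    have xb: "x \<bullet> b = (if b \<in> K then f b else 0)" if "b \<in> Basis" for b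
      unfolding x_def inner_sum_left using that K_def K(1)
      by (auto simp: inner_Basis if_distrib cong: if_cong) 
    show "(\<integral>\<^sup>+v. \<integral>\<^sup>+u. \<integral>\<^sup>+s. indicator T (V (f(j := v, i := u, k := s))) \<partial>lborel \<partial>lborel \<partial>lborel)
      \<le> B * indicator (\<Pi>\<^sub>E b\<in>K. {-R..R}) f"
    proof (cases "f \<in> (\<Pi>\<^sub>E b\<in>K. {-R..R})")
      case True
      then show ?thesis
        unfolding Vup x_def[symmetric] using ijk xb by (simp add: sect K_def)
    next
      case False
      then obtain b where b: "b \<in> K" "f b \<notin> {-R..R}"
        using f by (auto simp: space_PiM PiE_iff simp del: atLeastAtMost_iff)
      then have b': "\<not> \<bar>f b\<bar> \<le> R" by (auto simp: abs_le_iff)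
      \<comment> \<open>Moving in the three chosen directions leaves the \<open>b\<close>-coordinate
        unchanged, so one frozen coordinate outside the cube empties the whole slice.\<close>
      have "(x + v *\<^sub>R j + u *\<^sub>R i + s *\<^sub>R k) \<bullet> b = f b" for u v s
        using b(1) ijk xb[of b] by (auto simp: inner_add_left inner_Basis K_def)
      then have "x + v *\<^sub>R j + u *\<^sub>R i + s *\<^sub>R k \<notin> T" for u v s
        using box[of "x + v *\<^sub>R j + u *\<^sub>R i + s *\<^sub>R k" b] b(1) b' by (auto simp: K_def)
      then show ?thesis unfolding Vup x_def[symmetric] by simp
    qed
  qed
  also have "\<dots> = B * emeasure (\<Pi>\<^sub>M b\<in>K. lborel) (\<Pi>\<^sub>E b\<in>K. {-R..R})"
    using K(1) by (intro nn_integral_cmult_indicator sets_PiM_I_finite) auto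
  also have "emeasure (\<Pi>\<^sub>M b\<in>K. lborel) (\<Pi>\<^sub>E b\<in>K. {-R..R}) = (\<Prod>b\<in>K. emeasure lborel {-R..R})"
    using K(1) by (intro emeasure_PiM) auto
  also have "\<dots> = ennreal ((2 * R) ^ card K)"
    using R by (simp add: ennreal_power)
  also have "card K = DIM('a) - 3"
    using ijk by (simp add: K_def card_Diff_subset)
  finally show ?thesis .
qed

section \<open>Sublevel sets of two-variable quadratics, saddles included\<close>

text \<open>The value of \<open>x\<^sup>2 - \<omega>\<close> dominates the squared distance from
  \<open>x\<close> to the nearer of the roots \<open>w\<close> and \<open>- w\<close>. For negative
  \<omega> both are replaced by the vertex 0, and the bound persists.\<close>

lemma diff_sq_le_cases:
  fixes x \<omega> :: real
  defines "w \<equiv> sqrt (max 0 \<omega>)"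
  shows "(x - w)\<^sup>2 \<le> \<bar>x\<^sup>2 - \<omega>\<bar> \<or> (x + w)\<^sup>2 \<le> \<bar>x\<^sup>2 - \<omega>\<bar>"
proof -
  have w: "0 \<le> w" "w\<^sup>2 = max 0 \<omega>" by (auto simp: w_def)
  have le: "\<bar>x\<^sup>2 - w\<^sup>2\<bar> \<le> \<bar>x\<^sup>2 - \<omega>\<bar>" unfolding w(2) by (auto simp: max_def)
  show ?thesis
  proof (cases "0 \<le> x")
    case True
    then show ?thesis using same_sign_diff_le(1)[of x w] w le by auto
  next
    case False
    then have "0 \<le> x * (- w)" using w by (simp add: mult_nonpos_nonneg)
    then show ?thesis using same_sign_diff_le(1)[of x "- w"] le by auto
  qed
qed

text \<open>For fixed \<open>v\<close> the section in \<open>u\<close> is a one-variable sublevel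
  set at level \<open>K - B * (v - n)\<^sup>2\<close>. Its length is large only when that level is
  small, and there it is controlled by the inverse distance from \<open>v\<close> to one of
  \<open>n + w\<close>, \<open>n - w\<close>. Integrating in \<open>v\<close> gives the
  \<open>arsinh\<close>. Only absolute values of \<open>A\<close> and \<open>B\<close> enter, and
  the bound is uniform in \<open>m\<close>, \<open>n\<close> and \<open>K\<close>.\<close>

lemma quadratic_sublevel_plane:
  fixes A B K m n h \<sigma> lo hi :: real
  assumes "0 < \<sigma>" "\<sigma> \<le> \<bar>A\<bar>" "\<sigma> \<le> \<bar>B\<bar>" "0 < h" "lo \<le> hi"
  shows "(\<integral>\<^sup>+v. \<integral>\<^sup>+u. indicator {(u, v). v \<in> {lo..hi} \<and> \<bar>A * (u - m)\<^sup>2 + B * (v - n)\<^sup>2 - K\<bar> \<le> h} (u, v) \<partial>lborel \<partial>lborel)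
    \<le> ennreal (96 * h / \<sigma> * arsinh ((hi - lo) / sqrt (h / \<bar>B\<bar>)))"
proof -
  \<comment> \<open>At distance \<rho> from a center, \<open>\<bar>B\<bar>\<close> times the squared
    distance equals \<open>h\<close>; below this scale the inverse distance has to be cut
    off.\<close>
  define \<rho> where "\<rho> = sqrt (h / \<bar>B\<bar>)"
  define w where "w = sqrt (max 0 (K / B))"
  define g where "g = (\<lambda>c v. 1 / sqrt (\<rho>\<^sup>2 + (v - c)\<^sup>2))"
  define D where "D = 24 * h / \<sigma>"
  have AB: "A \<noteq> 0" "B \<noteq> 0" using assms by auto
  have \<rho>: "0 < \<rho>" "\<rho>\<^sup>2 = h / \<bar>B\<bar>" using assms AB by (auto simp: \<rho>_def)
  have D: "0 \<le> D" using assms by (simp add: D_def)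
  have g0: "0 \<le> g c v" for c v by (simp add: g_def)
  have gm: "g c \<in> borel_measurable borel" for c unfolding g_def by measurable
  \<comment> \<open>Which root is nearer depends on \<open>v\<close>; the sum over both gives one
    majorant valid for every \<open>v\<close>. The factor 24 in \<open>D\<close> is 12 times
    \<open>sqrt 4\<close>, from the estimate by \<open>4 * M\<close>.\<close>
  have bound: "12 * h / sqrt (\<bar>A\<bar> * max h \<bar>K - B * (v - n)\<^sup>2\<bar>) \<le> D * (g (n + w) v + g (n - w) v)" for v
  proof -
    define M where "M = max h \<bar>K - B * (v - n)\<^sup>2\<bar>"
    have M: "0 < M" using assms by (simp add: M_def)
    have E: "\<bar>K - B * (v - n)\<^sup>2\<bar> = \<bar>B\<bar> * \<bar>(v - n)\<^sup>2 - K / B\<bar>"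
      using AB by (simp add: abs_mult[symmetric] right_diff_distrib abs_minus_commute)
    obtain c where c: "c = n + w \<or> c = n - w" "(v - c)\<^sup>2 \<le> \<bar>(v - n)\<^sup>2 - K / B\<bar>"
    proof -
      have "(v - (n + w))\<^sup>2 \<le> \<bar>(v - n)\<^sup>2 - K / B\<bar> \<or> (v - (n - w))\<^sup>2 \<le> \<bar>(v - n)\<^sup>2 - K / B\<bar>"
        using diff_sq_le_cases[of "v - n" "K / B"] unfolding w_def[symmetric]
        by (simp add: diff_diff_eq diff_diff_eq2 diff_add_eq)
      then show thesis using that by blast
    qed
    have "\<bar>B\<bar> * (\<rho>\<^sup>2 + (v - c)\<^sup>2) = h + \<bar>B\<bar> * (v - c)\<^sup>2" using AB \<rho> by (simp add: distrib_left)
    also have "\<dots> \<le> h + \<bar>K - B * (v - n)\<^sup>2\<bar>"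
      unfolding E using c(2) by (intro add_left_mono mult_left_mono) auto
    also have "\<dots> \<le> 4 * M" using assms(4) by (auto simp: M_def max_def)
    finally have le: "\<bar>B\<bar> * (\<rho>\<^sup>2 + (v - c)\<^sup>2) \<le> 4 * M" .
    have pos: "0 < \<rho>\<^sup>2 + (v - c)\<^sup>2" using \<rho>(1) by (simp add: sum_power2_gt_zero_iff)
    have "\<sigma>\<^sup>2 * (\<rho>\<^sup>2 + (v - c)\<^sup>2) \<le> \<bar>A\<bar> * \<bar>B\<bar> * (\<rho>\<^sup>2 + (v - c)\<^sup>2)"
      using assms pos unfolding power2_eq_square[of \<sigma>] by (intro mult_right_mono mult_mono) auto
    also have "\<dots> \<le> \<bar>A\<bar> * (4 * M)" using le by (simp add: mult.assoc mult_left_mono)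
    finally have "sqrt (\<sigma>\<^sup>2 * (\<rho>\<^sup>2 + (v - c)\<^sup>2)) \<le> sqrt (4 * (\<bar>A\<bar> * M))"
      by (simp add: mult.left_commute)
    then have le2: "\<sigma> * sqrt (\<rho>\<^sup>2 + (v - c)\<^sup>2) \<le> 2 * sqrt (\<bar>A\<bar> * M)"
      using assms(1) by (simp add: real_sqrt_mult)
    have "12 * h / sqrt (\<bar>A\<bar> * M) = 24 * h / (2 * sqrt (\<bar>A\<bar> * M))" by simp
    also have "\<dots> \<le> 24 * h / (\<sigma> * sqrt (\<rho>\<^sup>2 + (v - c)\<^sup>2))"
      using le2 assms pos AB M by (intro divide_left_mono) auto
    also have "\<dots> = D * g c v" by (simp add: D_def g_def)
    also have "\<dots> \<le> D * (g (n + w) v + g (n - w) v)"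
      using c(1) g0 D by (intro mult_left_mono) (auto simp: add_increasing add_increasing2)
    finally show ?thesis by (simp add: M_def)
  qed
  have "(\<integral>\<^sup>+v. \<integral>\<^sup>+u. indicator {(u, v). v \<in> {lo..hi} \<and> \<bar>A * (u - m)\<^sup>2 + B * (v - n)\<^sup>2 - K\<bar> \<le> h} (u, v) \<partial>lborel \<partial>lborel)
    \<le> (\<integral>\<^sup>+v. ennreal D * (ennreal (g (n + w) v) * indicator {lo..hi} v + ennreal (g (n - w) v) * indicator {lo..hi} v) \<partial>lborel)"
  proof (rule nn_integral_mono)
    fix v :: real
    show "(\<integral>\<^sup>+u. indicator {(u, v). v \<in> {lo..hi} \<and> \<bar>A * (u - m)\<^sup>2 + B * (v - n)\<^sup>2 - K\<bar> \<le> h} (u, v) \<partial>lborel)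
      \<le> ennreal D * (ennreal (g (n + w) v) * indicator {lo..hi} v + ennreal (g (n - w) v) * indicator {lo..hi} v)"
    proof (cases "v \<in> {lo..hi}")
      case True
      have "(\<integral>\<^sup>+u. indicator {(u, v). v \<in> {lo..hi} \<and> \<bar>A * (u - m)\<^sup>2 + B * (v - n)\<^sup>2 - K\<bar> \<le> h} (u, v) \<partial>lborel)
        = (\<integral>\<^sup>+u. indicator {u. \<bar>A * (u - m)\<^sup>2 - (K - B * (v - n)\<^sup>2)\<bar> \<le> h} u \<partial>lborel)"
        using True by (intro nn_integral_cong) (auto split: split_indicator simp: algebra_simps)
      also have "\<dots> \<le> ennreal (12 * h / sqrt (\<bar>A\<bar> * max h \<bar>K - B * (v - n)\<^sup>2\<bar>))"
        by (rule quadratic_sublevel[OF AB(1) assms(4)])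
      also have "\<dots> \<le> ennreal (D * (g (n + w) v + g (n - w) v))" by (rule ennreal_leI[OF bound])
      also have "\<dots> = ennreal D * (ennreal (g (n + w) v) + ennreal (g (n - w) v))"
        using D g0 by (simp add: ennreal_mult ennreal_plus)
      finally show ?thesis using True by simp
    next
      case False
      then have nin: "(u, v) \<notin> {(u, v). v \<in> {lo..hi} \<and> \<bar>A * (u - m)\<^sup>2 + B * (v - n)\<^sup>2 - K\<bar> \<le> h}" for u by auto
      have "(\<integral>\<^sup>+u. indicator {(u, v). v \<in> {lo..hi} \<and> \<bar>A * (u - m)\<^sup>2 + B * (v - n)\<^sup>2 - K\<bar> \<le> h} (u, v) \<partial>lborel)
          = integral\<^sup>N lborel (\<lambda>_::real. 0)"
        by (intro nn_integral_cong indicator_simps(2) nin)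
      then show ?thesis by simp
    qed
  qed
  also have "\<dots> = ennreal D * ((\<integral>\<^sup>+v. ennreal (g (n + w) v) * indicator {lo..hi} v \<partial>lborel)
      + (\<integral>\<^sup>+v. ennreal (g (n - w) v) * indicator {lo..hi} v \<partial>lborel))"
    using gm by (subst nn_integral_cmult, measurable, subst nn_integral_add) auto
  also have "\<dots> \<le> ennreal D * (ennreal (2 * arsinh ((hi - lo) / \<rho>)) + ennreal (2 * arsinh ((hi - lo) / \<rho>)))"
    unfolding g_def using assms \<rho> by (intro mult_left_mono add_mono nn_integral_inverse_sqrt_le) auto
  also have "\<dots> = ennreal (D * (4 * arsinh ((hi - lo) / \<rho>)))"
  proof -
    have "0 \<le> arsinh ((hi - lo) / \<rho>)"
      using assms \<rho> by (cases "hi = lo") (auto simp: less_imp_le)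
    then have "ennreal (2 * arsinh ((hi - lo) / \<rho>)) + ennreal (2 * arsinh ((hi - lo) / \<rho>))
        = ennreal (4 * arsinh ((hi - lo) / \<rho>))"
      by (subst ennreal_plus[symmetric]) auto
    then show ?thesis using D by (simp only: ennreal_mult')
  qed
  finally show ?thesis by (simp add: D_def \<rho>_def mult_ac)
qed

lemma arsinh_le_ln:
  fixes x \<delta> :: real
  assumes "0 < \<delta>" "\<delta> \<le> 1/2" "0 \<le> x" "x \<le> 4 / \<delta>"
  shows "arsinh x \<le> 5 * ln (1 / \<delta>)"
proof -
  have "sqrt (x\<^sup>2 + 1) \<le> x + 1" using assms by (intro real_le_lsqrt) (auto simp: power2_sum)
  then have "x + sqrt (x\<^sup>2 + 1) \<le> 2 * (4 / \<delta>) + 1" using assms by linarith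
  also have "\<dots> \<le> 2 ^ 4 * (1 / \<delta>)" using assms by (simp add: field_simps)
  \<comment> \<open>Since \<open>1 / \<delta> \<ge> 2\<close>, the constant 16 is absorbed into four
    further powers of \<open>1 / \<delta>\<close>; this produces the factor 5.\<close>
  also have "\<dots> \<le> (1 / \<delta>) ^ 4 * (1 / \<delta>)"
    using assms by (intro mult_right_mono power_mono) (auto simp: field_simps)
  also have "\<dots> = (1 / \<delta>) ^ 5" by (simp add: eval_nat_numeral)
  finally have "ln (x + sqrt (x\<^sup>2 + 1)) \<le> ln ((1 / \<delta>) ^ 5)"
    using arsinh_real_aux[of x] by (intro ln_mono) auto
  then show ?thesis using assms by (simp add: arsinh_real_def ln_realpow)
qed

section \<open>Sections of the intersection in one, two and three coordinates\<close>

text \<open>This is the integration in the \<open>k\<close>-th coordinate, with \<open>X\<close> and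
  \<open>Y\<close> collecting the others. For \<open>\<kappa> \<le> \<bar>s\<bar>\<close> the square
  has slope at least \<open>2 * \<kappa>\<close>, which gives the length. Eliminating
  \<open>s\<^sup>2\<close> between the two conditions leaves a constraint on \<open>X\<close> and
  \<open>Y\<close> alone, which the \<open>of_bool\<close> factor hands to the outer
  integrals.\<close>

lemma abs_square_div_section:
  fixes a b X Y \<delta> \<kappa> :: real
  assumes "a \<in> {1..2}" "b \<in> {1..2}" "0 < \<delta>" "0 < \<kappa>"
  shows "(\<integral>\<^sup>+s. indicator {s. \<bar>s\<^sup>2 / a + X\<bar> < \<delta> \<and> \<bar>s\<^sup>2 / b + Y\<bar> < \<delta> \<and> \<kappa> \<le> \<bar>s\<bar>} s \<partial>lborel)
    \<le> ennreal (8 * \<delta> / \<kappa>) * of_bool (\<bar>a / b * X - Y\<bar> \<le> 3 * \<delta>)"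
proof (cases "\<bar>a / b * X - Y\<bar> \<le> 3 * \<delta>")
  case True
  have "\<bar>s - s'\<bar> \<le> 2 * \<delta> / \<kappa>"
    if "\<bar>s\<^sup>2 / a + X\<bar> < \<delta>" "\<bar>s'\<^sup>2 / a + X\<bar> < \<delta>" "\<kappa> \<le> \<bar>s\<bar>" "\<kappa> \<le> \<bar>s'\<bar>" "0 \<le> (s - 0) * (s' - 0)" for s s'
  proof -
    have "\<bar>s - s'\<bar> * (2 * \<kappa>) \<le> \<bar>s - s'\<bar> * \<bar>s + s'\<bar>"
      using same_sign_diff_le(3)[of s s'] that by (intro mult_left_mono) auto
    also have "\<dots> = \<bar>s\<^sup>2 - s'\<^sup>2\<bar>"
      by (simp add: power2_eq_square square_diff_square_factored abs_mult[symmetric] mult.commute)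
    also have "\<dots> = a * \<bar>s\<^sup>2 / a - s'\<^sup>2 / a\<bar>"
      using assms(1) by (simp flip: diff_divide_distrib)
    also have "\<dots> \<le> 2 * (2 * \<delta>)" using that assms(1) by (intro mult_mono) auto
    finally show ?thesis using assms(4) by (simp add: field_simps)
  qed
  then have "(\<integral>\<^sup>+s. indicator {s. \<bar>s\<^sup>2 / a + X\<bar> < \<delta> \<and> \<bar>s\<^sup>2 / b + Y\<bar> < \<delta> \<and> \<kappa> \<le> \<bar>s\<bar>} s \<partial>lborel)
    \<le> ennreal (4 * (2 * \<delta> / \<kappa>))"
    using assms by (intro nn_integral_indicator_le_diameter_signed[where m = 0]) auto
  then show ?thesis using True by simp
next
  case False
  have "\<not> (\<bar>s\<^sup>2 / a + X\<bar> < \<delta> \<and> \<bar>s\<^sup>2 / b + Y\<bar> < \<delta>)" for s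
  proof
    assume s: "\<bar>s\<^sup>2 / a + X\<bar> < \<delta> \<and> \<bar>s\<^sup>2 / b + Y\<bar> < \<delta>"
    \<comment> \<open>The weight \<open>a / b\<close> makes the two terms in
      \<open>s\<^sup>2\<close> cancel; as it is at most 2, the total error is
      \<open>2 * \<delta> + \<delta>\<close>.\<close>
    have "a / b * X - Y = a / b * (s\<^sup>2 / a + X) - (s\<^sup>2 / b + Y)"
      using assms by (simp add: field_simps)
    also have "\<bar>\<dots>\<bar> \<le> \<bar>a / b * (s\<^sup>2 / a + X)\<bar> + \<bar>s\<^sup>2 / b + Y\<bar>" by (rule abs_triangle_ineq4)
    also have "\<dots> \<le> 2 * \<delta> + \<delta>"
    proof (rule add_mono)
      have "a / b \<le> 2 / 1" using assms by (intro frac_le) auto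
      then show "\<bar>a / b * (s\<^sup>2 / a + X)\<bar> \<le> 2 * \<delta>"
        unfolding abs_mult using s assms by (intro mult_mono) auto
    qed (use s in auto)
    finally show False using False by simp
  qed
  then have "{s. \<bar>s\<^sup>2 / a + X\<bar> < \<delta> \<and> \<bar>s\<^sup>2 / b + Y\<bar> < \<delta> \<and> \<kappa> \<le> \<bar>s\<bar>} = {}" by blast
  then show ?thesis by (simp only:) simp
qed

text \<open>The nearly linear case: for \<open>\<bar>u - t1\<bar> \<le> 2\<close> the slope
  contributed by the small leading coefficient is at most half of the one,
  \<open>2 * \<bar>t1 - t2\<bar> / b\<close>, caused by the shift of centers, so the function is
  monotone with slope of order \<open>\<bar>t1 - t2\<bar>\<close>.\<close>

lemma quadratic_diff_section:
  fixes a b \<mu> t1 t2 E h :: real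
  assumes "b \<in> {1..2}" "t1 \<noteq> t2" "4 * \<bar>\<mu> / a - 1 / b\<bar> \<le> \<bar>t1 - t2\<bar> / b" "0 \<le> h"
  shows "(\<integral>\<^sup>+u. indicator {u. \<bar>u - t1\<bar> \<le> 2 \<and> \<bar>\<mu> * ((u - t1)\<^sup>2 / a) - (u - t2)\<^sup>2 / b + E\<bar> \<le> h} u \<partial>lborel)
    \<le> ennreal (8 * h / \<bar>t1 - t2\<bar>)"
proof -
  define A \<tau> where "A = \<mu> / a - 1 / b" and "\<tau> = t1 - t2"
  have "\<bar>u - v\<bar> \<le> 4 * h / \<bar>t1 - t2\<bar>"
    if uv: "\<bar>u - t1\<bar> \<le> 2" "\<bar>\<mu> * ((u - t1)\<^sup>2 / a) - (u - t2)\<^sup>2 / b + E\<bar> \<le> h"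
      "\<bar>v - t1\<bar> \<le> 2" "\<bar>\<mu> * ((v - t1)\<^sup>2 / a) - (v - t2)\<^sup>2 / b + E\<bar> \<le> h" for u v
  proof -
    define x y where "x = u - t1" and "y = v - t1"
    have u2: "u - t2 = x + \<tau>" "v - t2 = y + \<tau>" by (auto simp: x_def y_def \<tau>_def)
    have eq: "(x - y) * (A * (x + y) - 2 * (\<tau> / b))
      = (\<mu> * (x\<^sup>2 / a) - (x + \<tau>)\<^sup>2 / b + E) - (\<mu> * (y\<^sup>2 / a) - (y + \<tau>)\<^sup>2 / b + E)"
      by (simp add: A_def power2_eq_square divide_inverse algebra_simps)
    have 1: "\<bar>(x - y) * (A * (x + y) - 2 * (\<tau> / b))\<bar> \<le> 2 * h"
      unfolding eq using uv unfolding u2 x_def[symmetric] y_def[symmetric] by linarith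
    have "\<bar>A * (x + y)\<bar> \<le> \<bar>A\<bar> * 4"
      unfolding abs_mult using uv by (intro mult_left_mono) (auto simp: x_def y_def)
    also have "\<dots> \<le> \<bar>\<tau> / b\<bar>" using assms by (simp add: A_def \<tau>_def)
    finally have "\<bar>\<tau> / b\<bar> \<le> \<bar>A * (x + y) - 2 * (\<tau> / b)\<bar>" by linarith
    moreover have "\<bar>\<tau>\<bar> / 2 \<le> \<bar>\<tau> / b\<bar>" 
    proof -
      have "\<bar>\<tau>\<bar> / 2 \<le> \<bar>\<tau>\<bar> / b" using assms(1) by (intro divide_left_mono) auto
      then show ?thesis using assms(1) by (simp add: abs_divide)
    qed
    ultimately have "\<bar>\<tau>\<bar> / 2 \<le> \<bar>A * (x + y) - 2 * (\<tau> / b)\<bar>" by linarith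
    then have "\<bar>x - y\<bar> * (\<bar>\<tau>\<bar> / 2) \<le> 2 * h"
      using 1 unfolding abs_mult by (meson abs_ge_zero mult_left_mono order_trans)
    then have "\<bar>x - y\<bar> \<le> 4 * h / \<bar>\<tau>\<bar>" using assms by (simp add: \<tau>_def field_simps)
    then show ?thesis by (simp add: x_def y_def \<tau>_def)
  qed
  then have "(\<integral>\<^sup>+u. indicator {u. \<bar>u - t1\<bar> \<le> 2 \<and> \<bar>\<mu> * ((u - t1)\<^sup>2 / a) - (u - t2)\<^sup>2 / b + E\<bar> \<le> h} u \<partial>lborel)
    \<le> ennreal (2 * (4 * h / \<bar>t1 - t2\<bar>))"
    using assms by (intro nn_integral_indicator_le_diameter) auto
  then show ?thesis by simp
qed

text \<open>The vertex and the constant may be huge when the leading coefficient is small. Their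
  existence is enough because \<open>quadratic_sublevel_plane\<close> is uniform in them.\<close>

lemma quadratic_diff_complete_square:
  fixes a b \<mu> t1 t2 :: real
  assumes "\<mu> / a - 1 / b \<noteq> 0"
  shows "\<exists>m e. \<forall>u. \<mu> * ((u - t1)\<^sup>2 / a) - (u - t2)\<^sup>2 / b = (\<mu> / a - 1 / b) * (u - m)\<^sup>2 + e"
proof -
  define A \<tau> q where "A = \<mu> / a - 1 / b" and "\<tau> = t1 - t2" and "q = 1 / b"
  have "\<mu> * ((u - t1)\<^sup>2 / a) - (u - t2)\<^sup>2 / b = A * (u - (t1 + q * \<tau> / A))\<^sup>2 + (- (q * \<tau>)\<^sup>2 / A - q * \<tau>\<^sup>2)" for u
  proof -
    define z where "z = u - t1"
    have z: "u - t1 = z" "u - t2 = z + \<tau>" "u - (t1 + q * \<tau> / A) = z - q * \<tau> / A" by (auto simp: z_def \<tau>_def)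
    have "\<mu> * (z\<^sup>2 / a) - (z + \<tau>)\<^sup>2 / b = A * z\<^sup>2 - 2 * q * \<tau> * z - q * \<tau>\<^sup>2"
      by (simp add: A_def q_def power2_eq_square divide_inverse algebra_simps)
    moreover have "A * (z - q * \<tau> / A)\<^sup>2 + (- (q * \<tau>)\<^sup>2 / A - q * \<tau>\<^sup>2) = A * z\<^sup>2 - 2 * q * \<tau> * z - q * \<tau>\<^sup>2"
      using assms A_def by (simp add: power2_eq_square field_simps)
    ultimately show ?thesis unfolding z by simp
  qed
  then show ?thesis unfolding A_def by blast
qed

text \<open>The last hypothesis says that if one of the two leading coefficients is small, then the one
  of the inner variable is.\<close>

lemma plane_section_bound:
  fixes ai aj bi bj \<mu> t1 t2 E \<delta> :: real
  assumes ab: "ai \<in> {1..2}" "aj \<in> {1..2}" "bi \<in> {1..2}" "bj \<in> {1..2}" and \<mu>: "0 < \<mu>" "\<mu> \<le> 2"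
    and \<delta>: "0 < \<delta>" "\<delta> \<le> 1/2"
    and order: "4 * \<bar>\<mu> / aj - 1 / bj\<bar> \<le> \<bar>t1 - t2\<bar> / bj \<Longrightarrow> 4 * \<bar>\<mu> / ai - 1 / bi\<bar> \<le> \<bar>t1 - t2\<bar> / bi"
  shows "(\<integral>\<^sup>+v. \<integral>\<^sup>+u. indicator {(u, v). \<bar>u - t1\<bar> \<le> 2 \<and> \<bar>v - t1\<bar> \<le> 2 \<and>
        \<bar>\<mu> * ((u - t1)\<^sup>2 / ai) - (u - t2)\<^sup>2 / bi + (\<mu> * ((v - t1)\<^sup>2 / aj) - (v - t2)\<^sup>2 / bj) + E\<bar> \<le> 3 * \<delta>} (u, v)
      \<partial>lborel \<partial>lborel)
    \<le> ennreal (24000 * ln (1 / \<delta>) * (\<delta> / (\<delta> + \<bar>t1 - t2\<bar>)))"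
    (is "(\<integral>\<^sup>+v. \<integral>\<^sup>+u. indicator ?V (u, v) \<partial>lborel \<partial>lborel) \<le> ennreal ?rhs")
proof -
  define \<tau> where "\<tau> = \<bar>t1 - t2\<bar>"
  define L where "L = ln (1 / \<delta>)"
  \<comment> \<open>A positive lower bound on the logarithm lets the cases whose estimates contain
    no logarithm fit under the same right-hand side.\<close>
  have "exp (1/2) \<le> (2::real)"
    using exp_half_le2 by simp
  also have "2 \<le> 1 / \<delta>" using \<delta> by (simp add: field_simps)
  finally have L: "1/2 \<le> L" using \<delta> unfolding L_def by (subst ln_ge_iff) auto
  have box: "(\<integral>\<^sup>+v. ennreal c * indicator {t1 - 2..t1 + 2} v \<partial>lborel) = ennreal (4 * c)" if "0 \<le> c" for c
    using that by (subst nn_integral_cmult_indicator) (auto simp: ennreal_mult'' mult.commute)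
  have const: "ennreal c \<le> ennreal ?rhs" if "c * (\<delta> + \<tau>) \<le> 24000 * L * \<delta>" for c
  proof (rule ennreal_leI)
    have "c \<le> 24000 * L * \<delta> / (\<delta> + \<tau>)" using that \<delta> by (simp add: pos_le_divide_eq \<tau>_def)
    then show "c \<le> ?rhs" by (simp add: L_def \<tau>_def)
  qed
  \<comment> \<open>Close centers, where the trivial area 16 suffices; a nearly linear inner
    quadratic; two genuinely quadratic variables. By \<open>order\<close> a nearly linear outer
    quadratic forces a nearly linear inner one.\<close>
  consider "\<tau> \<le> \<delta>" | "\<delta> < \<tau>" "4 * \<bar>\<mu> / ai - 1 / bi\<bar> \<le> \<tau> / bi"
    | "\<delta> < \<tau>" "\<tau> / bi < 4 * \<bar>\<mu> / ai - 1 / bi\<bar>" "\<tau> / bj < 4 * \<bar>\<mu> / aj - 1 / bj\<bar>"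
    using order unfolding \<tau>_def by linarith
  then show ?thesis
  proof cases
    case 1
    have "(\<integral>\<^sup>+v. \<integral>\<^sup>+u. indicator ?V (u, v) \<partial>lborel \<partial>lborel)
      \<le> (\<integral>\<^sup>+v. ennreal 4 * indicator {t1 - 2..t1 + 2} v \<partial>lborel)"
    proof (rule nn_integral_mono)
      fix v :: real
      have "(\<integral>\<^sup>+u. indicator ?V (u, v) \<partial>lborel)
          \<le> (\<integral>\<^sup>+u. indicator {t1 - 2..t1 + 2} v * indicator {t1 - 2..t1 + 2} u \<partial>lborel)"
        by (intro nn_integral_mono) (auto split: split_indicator)
      also have "\<dots> = ennreal 4 * indicator {t1 - 2..t1 + 2} v"
        by (subst nn_integral_cmult_indicator) (auto simp: mult.commute)
      finally show "(\<integral>\<^sup>+u. indicator ?V (u, v) \<partial>lborel) \<le> ennreal 4 * indicator {t1 - 2..t1 + 2} v" .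
    qed
    also have "\<dots> = ennreal 16" by (subst box) auto
    also have "\<dots> \<le> ennreal ?rhs"
    proof (rule const)
      have "16 * (\<delta> + \<tau>) \<le> 24000 * (1/2) * \<delta>" using 1 \<delta> by simp
      also have "\<dots> \<le> 24000 * L * \<delta>" using L \<delta> by (intro mult_right_mono) auto
      finally show "16 * (\<delta> + \<tau>) \<le> 24000 * L * \<delta>" .
    qed
    finally show ?thesis .
  next
    case 2
    have "(\<integral>\<^sup>+v. \<integral>\<^sup>+u. indicator ?V (u, v) \<partial>lborel \<partial>lborel)
      \<le> (\<integral>\<^sup>+v. ennreal (8 * (3 * \<delta>) / \<tau>) * indicator {t1 - 2..t1 + 2} v \<partial>lborel)"
    proof (rule nn_integral_mono)
      fix v :: real
      define G where "G = \<mu> * ((v - t1)\<^sup>2 / aj) - (v - t2)\<^sup>2 / bj + E"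
      show "(\<integral>\<^sup>+u. indicator ?V (u, v) \<partial>lborel) \<le> ennreal (8 * (3 * \<delta>) / \<tau>) * indicator {t1 - 2..t1 + 2} v"
      proof (cases "v \<in> {t1 - 2..t1 + 2}")
        case True
        have "(\<integral>\<^sup>+u. indicator ?V (u, v) \<partial>lborel) \<le> (\<integral>\<^sup>+u. indicator
          {u. \<bar>u - t1\<bar> \<le> 2 \<and> \<bar>\<mu> * ((u - t1)\<^sup>2 / ai) - (u - t2)\<^sup>2 / bi + G\<bar> \<le> 3 * \<delta>} u \<partial>lborel)"
          by (intro nn_integral_mono) (auto split: split_indicator simp: G_def add.assoc)
        also have "\<dots> \<le> ennreal (8 * (3 * \<delta>) / \<tau>)"
          unfolding \<tau>_def using ab 2 \<delta> by (intro quadratic_diff_section) (auto simp: \<tau>_def)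
        finally show ?thesis using True by simp
      next
        case False
        then have nin: "(u, v) \<notin> ?V" for u by auto
        have "(\<integral>\<^sup>+u. indicator ?V (u, v) \<partial>lborel) = integral\<^sup>N lborel (\<lambda>_::real. 0)"
          by (intro nn_integral_cong indicator_simps(2) nin)
        then show ?thesis by simp
      qed
    qed
    also have "\<dots> = ennreal (4 * (8 * (3 * \<delta>) / \<tau>))" using \<delta> by (subst box) (auto simp: \<tau>_def)
    also have "\<dots> \<le> ennreal ?rhs"
    proof (rule const)
      have "4 * (8 * (3 * \<delta>) / \<tau>) * (\<delta> + \<tau>) \<le> 4 * (8 * (3 * \<delta>) / \<tau>) * (2 * \<tau>)"
        using 2 \<delta> by (intro mult_left_mono) auto
      also have "\<dots> \<le> 24000 * (1/2) * \<delta>" using 2 \<delta> by simp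
      also have "\<dots> \<le> 24000 * L * \<delta>" using L \<delta> by (intro mult_right_mono) auto
      finally show "4 * (8 * (3 * \<delta>) / \<tau>) * (\<delta> + \<tau>) \<le> 24000 * L * \<delta>" .
    qed
    finally show ?thesis .
  next
    case 3
    define A B where "A = \<mu> / ai - 1 / bi" and "B = \<mu> / aj - 1 / bj"
    have \<tau>: "0 < \<tau>" using 3 \<delta> by simp
    have half: "\<tau> / 2 \<le> \<tau> / b" if "b \<in> {1..2}" for b
      using that \<tau> by (intro divide_left_mono) auto
    have A: "\<tau> / 8 \<le> \<bar>A\<bar>" using half[OF ab(3)] 3(2)[folded A_def] by linarith
    have B: "\<tau> / 8 \<le> \<bar>B\<bar>" using half[OF ab(4)] 3(3)[folded B_def] by linarith
    note AB = A B
    have "A \<noteq> 0" "B \<noteq> 0" using AB \<tau> by auto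
    then obtain m e n f where
      m: "\<And>u. \<mu> * ((u - t1)\<^sup>2 / ai) - (u - t2)\<^sup>2 / bi = A * (u - m)\<^sup>2 + e" and
      n: "\<And>v. \<mu> * ((v - t1)\<^sup>2 / aj) - (v - t2)\<^sup>2 / bj = B * (v - n)\<^sup>2 + f"
      using quadratic_diff_complete_square[of \<mu> ai bi t1 t2] quadratic_diff_complete_square[of \<mu> aj bj t1 t2]
      unfolding A_def B_def by metis
    have B2: "\<bar>B\<bar> \<le> 2"
    proof -
      have "\<mu> / aj \<le> 2 / 1" using ab \<mu> by (intro frac_le) auto
      moreover have "1 / bj \<le> 1" "0 \<le> 1 / bj" "0 \<le> \<mu> / aj" using ab \<mu> by auto
      ultimately show ?thesis unfolding B_def by linarith
    qed
    \<comment> \<open>The 4 is the length of the range of \<open>v\<close>; this brings the argument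
      of \<open>arsinh\<close> within the range of \<open>arsinh_le_ln\<close>.\<close>
    have \<rho>: "4 / sqrt (3 * \<delta> / \<bar>B\<bar>) \<le> 4 / \<delta>"
    proof -
      have "\<delta>\<^sup>2 \<le> 3 * \<delta> / 2" using \<delta> by (simp add: power2_eq_square)
      also have "\<dots> \<le> 3 * \<delta> / \<bar>B\<bar>" using B2 \<delta> \<open>B \<noteq> 0\<close> by (intro divide_left_mono) auto
      finally have "\<delta> \<le> sqrt (3 * \<delta> / \<bar>B\<bar>)" using \<delta> by (intro real_le_rsqrt)
      then show ?thesis using \<delta> \<open>B \<noteq> 0\<close> by (intro divide_left_mono) auto
    qed
    have "(\<integral>\<^sup>+v. \<integral>\<^sup>+u. indicator ?V (u, v) \<partial>lborel \<partial>lborel)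
      \<le> (\<integral>\<^sup>+v. \<integral>\<^sup>+u. indicator {(u, v). v \<in> {t1 - 2..t1 + 2} \<and>
          \<bar>A * (u - m)\<^sup>2 + B * (v - n)\<^sup>2 - (- E - e - f)\<bar> \<le> 3 * \<delta>} (u, v) \<partial>lborel \<partial>lborel)"
      unfolding m n by (intro nn_integral_mono) (auto split: split_indicator simp: algebra_simps)
    also have "\<dots> \<le> ennreal (96 * (3 * \<delta>) / (\<tau> / 8) * arsinh ((t1 + 2 - (t1 - 2)) / sqrt (3 * \<delta> / \<bar>B\<bar>)))"
      using \<tau> AB \<delta> by (intro quadratic_sublevel_plane) auto
    also have "\<dots> \<le> ennreal (96 * (3 * \<delta>) / (\<tau> / 8) * (5 * L))"
    proof (intro ennreal_leI mult_left_mono)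
      show "arsinh ((t1 + 2 - (t1 - 2)) / sqrt (3 * \<delta> / \<bar>B\<bar>)) \<le> 5 * L"
        unfolding L_def using \<rho> \<delta> by (intro arsinh_le_ln) auto
    qed (use \<tau> \<delta> in auto)
    also have "\<dots> \<le> ennreal ?rhs"
    proof (rule const)
      \<comment> \<open>The product 96 * 3 * 8 * 5 * 2 = 23040 is the source of the constant
        24000.\<close>
      have "96 * (3 * \<delta>) / (\<tau> / 8) * (5 * L) * (\<delta> + \<tau>) \<le> 96 * (3 * \<delta>) / (\<tau> / 8) * (5 * L) * (2 * \<tau>)"
        using 3 \<delta> L by (intro mult_left_mono) auto
      also have "\<dots> \<le> 24000 * L * \<delta>" using \<tau> \<delta> L by simp
      finally show "96 * (3 * \<delta>) / (\<tau> / 8) * (5 * L) * (\<delta> + \<tau>) \<le> 24000 * L * \<delta>" .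
    qed
    finally show ?thesis .
  qed
qed

text \<open>Each of the two powers of \<delta> has its own source: the length of the section in
  \<open>s\<close>, and the area of the set of pairs \<open>(u, v)\<close> over which that section
  can be nonempty. The constant is 8 * 24000.\<close>

lemma space_section_bound:
  fixes ai aj ak bi bj bk t1 t2 E1 E2 \<delta> \<kappa> :: real
  assumes ab: "ai \<in> {1..2}" "aj \<in> {1..2}" "ak \<in> {1..2}" "bi \<in> {1..2}" "bj \<in> {1..2}" "bk \<in> {1..2}"
    and \<delta>: "0 < \<delta>" "\<delta> \<le> 1/2" and \<kappa>: "0 < \<kappa>"
    and order: "4 * \<bar>ak / bk / aj - 1 / bj\<bar> \<le> \<bar>t1 - t2\<bar> / bj \<Longrightarrow> 4 * \<bar>ak / bk / ai - 1 / bi\<bar> \<le> \<bar>t1 - t2\<bar> / bi"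
  shows "(\<integral>\<^sup>+v. \<integral>\<^sup>+u. \<integral>\<^sup>+s. indicator {(u, v, s). \<bar>u - t1\<bar> \<le> 2 \<and> \<bar>v - t1\<bar> \<le> 2 \<and> \<kappa> \<le> \<bar>s\<bar> \<and>
        \<bar>s\<^sup>2 / ak + ((u - t1)\<^sup>2 / ai + (v - t1)\<^sup>2 / aj + E1)\<bar> < \<delta> \<and>
        \<bar>s\<^sup>2 / bk + ((u - t2)\<^sup>2 / bi + (v - t2)\<^sup>2 / bj + E2)\<bar> < \<delta>} (u, v, s) \<partial>lborel \<partial>lborel \<partial>lborel)
    \<le> ennreal (192000 / \<kappa> * ln (1 / \<delta>) * (\<delta>\<^sup>2 / (\<delta> + \<bar>t1 - t2\<bar>)))"
    (is "(\<integral>\<^sup>+v. \<integral>\<^sup>+u. \<integral>\<^sup>+s. indicator ?S (u, v, s) \<partial>lborel \<partial>lborel \<partial>lborel) \<le> _")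
proof -
  define \<mu> where "\<mu> = ak / bk"
  define V where "V = {(u, v). \<bar>u - t1\<bar> \<le> 2 \<and> \<bar>v - t1\<bar> \<le> 2 \<and>
    \<bar>\<mu> * ((u - t1)\<^sup>2 / ai) - (u - t2)\<^sup>2 / bi + (\<mu> * ((v - t1)\<^sup>2 / aj) - (v - t2)\<^sup>2 / bj) + (\<mu> * E1 - E2)\<bar> \<le> 3 * \<delta>}"
  have "V \<in> sets borel"
    unfolding V_def case_prod_beta divide_inverse
    by (intro borel_closed closed_Collect_conj closed_Collect_le continuous_intros)
  then have V[measurable]: "V \<in> sets (lborel \<Otimes>\<^sub>M lborel)" by (simp only: lborel_prod sets_lborel)
  have "ak / bk \<le> 2 / 1" using ab by (intro frac_le) auto
  then have \<mu>: "0 < \<mu>" "\<mu> \<le> 2" using ab by (auto simp: \<mu>_def)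
  have s: "(\<integral>\<^sup>+s. indicator ?S (u, v, s) \<partial>lborel) \<le> ennreal (8 * \<delta> / \<kappa>) * indicator V (u, v)" for u v
  proof (cases "\<bar>u - t1\<bar> \<le> 2 \<and> \<bar>v - t1\<bar> \<le> 2")
    case True
    define X Y where "X = (u - t1)\<^sup>2 / ai + (v - t1)\<^sup>2 / aj + E1" and "Y = (u - t2)\<^sup>2 / bi + (v - t2)\<^sup>2 / bj + E2"
    have "\<mu> * X - Y = \<mu> * ((u - t1)\<^sup>2 / ai) - (u - t2)\<^sup>2 / bi + (\<mu> * ((v - t1)\<^sup>2 / aj) - (v - t2)\<^sup>2 / bj) + (\<mu> * E1 - E2)"
      by (simp add: X_def Y_def algebra_simps)
    then have V: "indicator V (u, v) = (of_bool (\<bar>ak / bk * X - Y\<bar> \<le> 3 * \<delta>) :: ennreal)"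
      using True by (simp add: V_def \<mu>_def indicator_def)
    have "(\<integral>\<^sup>+s. indicator ?S (u, v, s) \<partial>lborel)
      = (\<integral>\<^sup>+s. indicator {s. \<bar>s\<^sup>2 / ak + X\<bar> < \<delta> \<and> \<bar>s\<^sup>2 / bk + Y\<bar> < \<delta> \<and> \<kappa> \<le> \<bar>s\<bar>} s \<partial>lborel)"
      unfolding X_def Y_def using True by (intro nn_integral_cong) (simp add: indicator_def conj_ac)
    also have "\<dots> \<le> ennreal (8 * \<delta> / \<kappa>) * of_bool (\<bar>ak / bk * X - Y\<bar> \<le> 3 * \<delta>)"
      using ab \<delta> \<kappa> by (intro abs_square_div_section) auto
    finally show ?thesis unfolding V .
  next
    case False
    then have nin: "(u, v, s) \<notin> ?S" for s by auto
    have "(\<integral>\<^sup>+s. indicator ?S (u, v, s) \<partial>lborel) = integral\<^sup>N lborel (\<lambda>_::real. 0)"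
      by (intro nn_integral_cong indicator_simps(2) nin)
    then show ?thesis by simp
  qed
  have "(\<integral>\<^sup>+v. \<integral>\<^sup>+u. \<integral>\<^sup>+s. indicator ?S (u, v, s) \<partial>lborel \<partial>lborel \<partial>lborel)
    \<le> (\<integral>\<^sup>+v. \<integral>\<^sup>+u. ennreal (8 * \<delta> / \<kappa>) * indicator V (u, v) \<partial>lborel \<partial>lborel)"
    by (intro nn_integral_mono s)
  also have "\<dots> = ennreal (8 * \<delta> / \<kappa>) * (\<integral>\<^sup>+v. \<integral>\<^sup>+u. indicator V (u, v) \<partial>lborel \<partial>lborel)"
    by (simp add: nn_integral_cmult)
  also have "\<dots> \<le> ennreal (8 * \<delta> / \<kappa>) * ennreal (24000 * ln (1 / \<delta>) * (\<delta> / (\<delta> + \<bar>t1 - t2\<bar>)))"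
    unfolding V_def using ab \<mu> \<delta> order by (intro mult_left_mono plane_section_bound) (auto simp: \<mu>_def)
  also have "\<dots> = ennreal (192000 / \<kappa> * ln (1 / \<delta>) * (\<delta>\<^sup>2 / (\<delta> + \<bar>t1 - t2\<bar>)))"
    using \<delta> \<kappa> by (subst ennreal_mult'[symmetric]) (auto simp: power2_eq_square mult_ac)
  finally show ?thesis .
qed

section \<open>The intersection of the two ellipsoidal shells\<close>

lemma emeasure_ell_nbhd_part_Int_le:
  fixes r1 r2 :: "real ^ 'n::finite" and k :: 'n
  assumes n: "CARD('n) \<ge> 3" and c: "0 < c" "c \<le> 1/2" and \<delta>: "0 < \<delta>" "\<delta> \<le> 1/2"
    and t1: "t1 \<in> {-1..1}"
    and r1: "\<And>j. r1 $ j \<in> {1..1 + c\<^sup>2}" and r2: "\<And>j. r2 $ j \<in> {1..1 + c\<^sup>2}"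
  shows "emeasure lebesgue
      (ell_nbhd_part c \<delta> k (t1 *\<^sub>R dir_vec k) r1 \<inter> ell_nbhd_part c \<delta> k (t2 *\<^sub>R dir_vec k) r2)
    \<le> ennreal (192000 / root 3 (2 * c) * 6 ^ (CARD('n) - 3) * ln (1 / \<delta>) * (\<delta>\<^sup>2 / (\<delta> + \<bar>t1 - t2\<bar>)))"
proof -
  define \<kappa> where "\<kappa> = root 3 (2 * c)"
  have \<kappa>: "0 < \<kappa>" using c by (simp add: \<kappa>_def)
  define a b where "a = (\<lambda>j. (r1 $ j)\<^sup>2)" and "b = (\<lambda>j. (r2 $ j)\<^sup>2)"
  \<comment> \<open>With \<open>c \<le> 1/2\<close> the radii are at most 5/4, so the squared radii
    lie in the interval from 1 to 2 that the section bounds require.\<close>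
  have c2: "1 + c\<^sup>2 \<le> 5/4" using power_mono[of c "1/2" 2] c by (simp add: power2_eq_square)
  have r_sq: "r\<^sup>2 \<in> {1..25/16}" if "r \<in> {1..1 + c\<^sup>2}" for r :: real
    using that c2 power_mono[of 1 r 2] power_mono[of r "5/4" 2] by (auto simp: power2_eq_square)
  have a: "a j \<in> {1..25/16}" and b: "b j \<in> {1..25/16}" for j
    using r_sq[OF r1] r_sq[OF r2] by (auto simp: a_def b_def)
  have ab: "a j \<in> {1..2}" "b j \<in> {1..2}" for j using a[of j] b[of j] by auto
  define x1 x2 where "x1 = t1 *\<^sub>R dir_vec k" and "x2 = t2 *\<^sub>R dir_vec k"
  \<comment> \<open>A Borel superset: membership in the image of \<open>Omega_set\<close> is
    weakened to a lower bound on the \<open>k\<close>-th coordinate. It holds because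
    \<open>dir_vec k\<close> vanishes there, so this coordinate is \<open>r1 $ k\<close> times that
    of \<omega>, with \<open>r1 $ k \<ge> 1\<close>.\<close>
  define T where "T = {y. \<bar>ell_fun x1 r1 y\<bar> < \<delta> \<and> \<bar>ell_fun x2 r2 y\<bar> < \<delta> \<and> \<kappa> \<le> \<bar>y $ k\<bar>}"
  have x: "x1 $ j = (if j = k then 0 else t1)" "x2 $ j = (if j = k then 0 else t2)" for j
    by (auto simp: x1_def x2_def dir_vec_def)
  have sub: "ell_nbhd_part c \<delta> k x1 r1 \<inter> ell_nbhd_part c \<delta> k x2 r2 \<subseteq> T"
  proof
    fix y assume y: "y \<in> ell_nbhd_part c \<delta> k x1 r1 \<inter> ell_nbhd_part c \<delta> k x2 r2"
    then obtain \<omega> where \<omega>: "y = ell_map x1 r1 \<omega>" "2 * c \<le> \<bar>\<omega> $ k\<bar> ^ 3"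
      by (auto simp: ell_nbhd_part_def Omega_set_def)
    have "\<kappa> \<le> root 3 (\<bar>\<omega> $ k\<bar> ^ 3)" unfolding \<kappa>_def using \<omega>(2) by (intro real_root_le_mono) auto
    also have "\<dots> = \<bar>\<omega> $ k\<bar>" by (intro real_root_power_cancel) auto
    also have "\<dots> = 1 * \<bar>\<omega> $ k\<bar>" by simp
    also have "\<dots> \<le> \<bar>r1 $ k\<bar> * \<bar>\<omega> $ k\<bar>" using r1[of k] by (intro mult_right_mono) auto
    also have "\<dots> = \<bar>y $ k\<bar>" by (simp add: \<omega>(1) ell_map_def x abs_mult)
    finally show "y \<in> T" using y by (simp add: T_def ell_nbhd_part_def ell_nbhd_def)
  qed
  have box: "\<bar>y $ j - x1 $ j\<bar> \<le> 2" if "y \<in> T" for y j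
  proof -
    have "(y $ j - x1 $ j)\<^sup>2 / a j \<le> (\<Sum>j\<in>UNIV. (y $ j - x1 $ j)\<^sup>2 / a j)"
      using a by (intro member_le_sum) (auto intro!: divide_nonneg_nonneg simp: a_def)
    also have "\<dots> \<le> 3/2" using that \<delta> by (auto simp: T_def ell_fun_def a_def)
    finally have "(y $ j - x1 $ j)\<^sup>2 \<le> 3/2 * a j" using a[of j] by (simp add: pos_divide_le_eq)
    also have "\<dots> \<le> 2\<^sup>2" using a[of j] by simp
    finally show ?thesis using abs_le_square_iff[of "y $ j - x1 $ j" 2] by simp
  qed
  have T: "T \<in> sets borel"
  proof -
    have "T = {y. \<bar>ell_fun x1 r1 y\<bar> < \<delta>} \<inter> {y. \<bar>ell_fun x2 r2 y\<bar> < \<delta>} \<inter> {y. \<kappa> \<le> \<bar>y $ k\<bar>}"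
      by (auto simp: T_def)
    moreover have "open {y. \<bar>ell_fun x r y\<bar> < \<delta>}" for x r :: "real ^ 'n"
      unfolding ell_fun_def divide_inverse by (intro open_Collect_less continuous_intros)
    moreover have "closed {y :: real ^ 'n. \<kappa> \<le> \<bar>y $ k\<bar>}"
      by (intro closed_Collect_le continuous_intros)
    ultimately show ?thesis by auto
  qed
  define P where "P = (\<lambda>l. 4 * \<bar>a k / b k / a l - 1 / b l\<bar> \<le> \<bar>t1 - t2\<bar> / b l)"
  \<comment> \<open>The dimension assumption leaves two coordinates besides \<open>k\<close>. Of two
    propositions one always implies the other, so a suitable naming of the pair achieves
    \<open>P j \<Longrightarrow> P i\<close>.\<close>
  obtain i j where ij: "i \<noteq> j" "i \<noteq> k" "j \<noteq> k" "P j \<Longrightarrow> P i"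
  proof -
    have "2 \<le> card (UNIV - {k})" using n by (simp add: card_Diff_subset)
    then obtain A where "A \<subseteq> UNIV - {k}" "card A = 2"
      by (rule obtain_subset_with_card_n)
    then obtain p q where pq: "p \<in> UNIV - {k}" "q \<in> UNIV - {k}" "p \<noteq> q"
      by (auto simp: card_2_iff)
    show thesis using that[of p q] that[of q p] pq by blast
  qed
  have sect: "(\<integral>\<^sup>+v. \<integral>\<^sup>+u. \<integral>\<^sup>+s. indicator T (x + v *\<^sub>R axis j 1 + u *\<^sub>R axis i 1 + s *\<^sub>R axis k 1) \<partial>lborel \<partial>lborel \<partial>lborel)
    \<le> ennreal (192000 / \<kappa> * ln (1 / \<delta>) * (\<delta>\<^sup>2 / (\<delta> + \<bar>t1 - t2\<bar>)))"
    if x0: "x \<bullet> axis i 1 = 0" "x \<bullet> axis j 1 = 0" "x \<bullet> axis k 1 = 0" for x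
  proof -
    have x0': "x $ i = 0" "x $ j = 0" "x $ k = 0" using x0 by (auto simp: inner_axis)
    define E1 E2 where "E1 = (\<Sum>l\<in>UNIV - {i, j, k}. (x $ l - x1 $ l)\<^sup>2 / a l) - 1"
      and "E2 = (\<Sum>l\<in>UNIV - {i, j, k}. (x $ l - x2 $ l)\<^sup>2 / b l) - 1"
    define S where "S = {(u, v, s). \<bar>u - t1\<bar> \<le> 2 \<and> \<bar>v - t1\<bar> \<le> 2 \<and> \<kappa> \<le> \<bar>s\<bar> \<and>
        \<bar>s\<^sup>2 / a k + ((u - t1)\<^sup>2 / a i + (v - t1)\<^sup>2 / a j + E1)\<bar> < \<delta> \<and>
        \<bar>s\<^sup>2 / b k + ((u - t2)\<^sup>2 / b i + (v - t2)\<^sup>2 / b j + E2)\<bar> < \<delta>}"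
    have mem: "(u, v, s) \<in> S" if yT: "x + v *\<^sub>R axis j 1 + u *\<^sub>R axis i 1 + s *\<^sub>R axis k 1 \<in> T" for u v s
    proof -
      define y where "y = x + v *\<^sub>R axis j 1 + u *\<^sub>R axis i 1 + s *\<^sub>R axis k 1"
      have yc: "y $ i = u" "y $ j = v" "y $ k = s" "l \<notin> {i, j, k} \<Longrightarrow> y $ l = x $ l" for l
        using ij x0' by (auto simp: y_def axis_def)
      have sum: "(\<Sum>l\<in>UNIV. f l) = f k + (f i + f j + (\<Sum>l\<in>UNIV - {i, j, k}. f l))" for f :: "'n \<Rightarrow> real"
      proof -
        have "(\<Sum>l\<in>UNIV. f l) = (\<Sum>l\<in>{i, j, k}. f l) + (\<Sum>l\<in>UNIV - {i, j, k}. f l)"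
          by (subst sum.subset_diff[of "{i, j, k}"]) auto
        then show ?thesis using ij by simp
      qed
      have "ell_fun x1 r1 y = s\<^sup>2 / a k + ((u - t1)\<^sup>2 / a i + (v - t1)\<^sup>2 / a j + E1)"
        unfolding ell_fun_def sum E1_def a_def using ij by (simp add: yc x)
      moreover have "ell_fun x2 r2 y = s\<^sup>2 / b k + ((u - t2)\<^sup>2 / b i + (v - t2)\<^sup>2 / b j + E2)"
        unfolding ell_fun_def sum E2_def b_def using ij by (simp add: yc x)
      moreover have "\<bar>u - t1\<bar> \<le> 2" "\<bar>v - t1\<bar> \<le> 2"
        using box[OF yT, folded y_def, of i] box[OF yT, folded y_def, of j] ij by (auto simp: yc x)
      ultimately show ?thesis using yT unfolding y_def[symmetric] by (simp add: S_def T_def yc)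
    qed
    have "(\<integral>\<^sup>+v. \<integral>\<^sup>+u. \<integral>\<^sup>+s. indicator T (x + v *\<^sub>R axis j 1 + u *\<^sub>R axis i 1 + s *\<^sub>R axis k 1) \<partial>lborel \<partial>lborel \<partial>lborel)
      \<le> (\<integral>\<^sup>+v. \<integral>\<^sup>+u. \<integral>\<^sup>+s. indicator S (u, v, s) \<partial>lborel \<partial>lborel \<partial>lborel)"
      using mem by (intro nn_integral_mono) (auto simp: indicator_def)
    also have "\<dots> \<le> ennreal (192000 / \<kappa> * ln (1 / \<delta>) * (\<delta>\<^sup>2 / (\<delta> + \<bar>t1 - t2\<bar>)))"
      unfolding S_def using ab \<delta> \<kappa> ij(4) unfolding P_def by (intro space_section_bound) auto
    finally show ?thesis .
  qed
  have "emeasure lebesgue (ell_nbhd_part c \<delta> k x1 r1 \<inter> ell_nbhd_part c \<delta> k x2 r2) \<le> emeasure lborel T"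
    using emeasure_mono[OF sub, of lebesgue] T by simp
  \<comment> \<open>The box radius 3 is the distance 2 from the first center plus
    \<open>\<bar>t1\<bar> \<le> 1\<close>.\<close>
  also have "\<dots> \<le> ennreal (192000 / \<kappa> * ln (1 / \<delta>) * (\<delta>\<^sup>2 / (\<delta> + \<bar>t1 - t2\<bar>))) * ennreal ((2 * 3) ^ (DIM(real ^ 'n) - 3))"
  proof (rule emeasure_lborel_le_three_sections[OF T _ _ _ _ _ _ _ _ sect])
    fix y and e :: "real ^ 'n" assume y: "y \<in> T" and "e \<in> Basis"
    then obtain l where e: "e = axis l 1" by (auto simp: Basis_vec_def)
    show "\<bar>y \<bullet> e\<bar> \<le> 3"
      using box[OF y, of l] t1 by (auto simp: e inner_axis x split: if_splits)
  qed (use ij in \<open>auto simp: axis_eq_axis\<close>)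
  also have "\<dots> = ennreal (192000 / \<kappa> * 6 ^ (CARD('n) - 3) * ln (1 / \<delta>) * (\<delta>\<^sup>2 / (\<delta> + \<bar>t1 - t2\<bar>)))"
    by (subst ennreal_mult''[symmetric]) (simp_all add: mult_ac)
  finally show ?thesis by (simp add: x1_def x2_def \<kappa>_def)
qed

theorem lemma2p2:
  assumes "CARD('n::finite) \<ge> 3"
  shows "\<exists>\<gamma>::real. 0 < \<gamma> \<and> \<gamma> < 1 \<and>
    (\<forall>c. 0 < c \<and> c \<le> \<gamma> \<longrightarrow>
      (\<exists>C>0. \<forall>(k::'n) (\<delta>::real) (t1::real) (t2::real) (r1::real ^ 'n) (r2::real ^ 'n).
        0 < \<delta> \<and> \<delta> \<le> 1 / 2 \<and> t1 \<in> {-1..1} \<and> t2 \<in> {-1..1} \<and>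
        (\<forall>j. r1 $ j \<in> {1..1 + c\<^sup>2}) \<and> (\<forall>j. r2 $ j \<in> {1..1 + c\<^sup>2}) \<longrightarrow>
        emeasure lebesgue
            (ell_nbhd_part c \<delta> k (t1 *\<^sub>R dir_vec k) r1 \<inter> ell_nbhd_part c \<delta> k (t2 *\<^sub>R dir_vec k) r2)
          \<le> ennreal (C * ln (1 / \<delta>) * (\<delta>\<^sup>2 / (\<delta> + \<bar>t1 - t2\<bar>)))))"
proof (rule exI[of _ "1/2"], intro conjI allI impI)
  fix c :: real assume c: "0 < c \<and> c \<le> 1/2"
  show "\<exists>C>0. \<forall>(k::'n) (\<delta>::real) (t1::real) (t2::real) (r1::real ^ 'n) (r2::real ^ 'n).
        0 < \<delta> \<and> \<delta> \<le> 1 / 2 \<and> t1 \<in> {-1..1} \<and> t2 \<in> {-1..1} \<and>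
        (\<forall>j. r1 $ j \<in> {1..1 + c\<^sup>2}) \<and> (\<forall>j. r2 $ j \<in> {1..1 + c\<^sup>2}) \<longrightarrow>
        emeasure lebesgue
            (ell_nbhd_part c \<delta> k (t1 *\<^sub>R dir_vec k) r1 \<inter> ell_nbhd_part c \<delta> k (t2 *\<^sub>R dir_vec k) r2)
          \<le> ennreal (C * ln (1 / \<delta>) * (\<delta>\<^sup>2 / (\<delta> + \<bar>t1 - t2\<bar>)))"
    using c by (intro exI[of _ "192000 / root 3 (2 * c) * 6 ^ (CARD('n) - 3)"] conjI allI impI
        emeasure_ell_nbhd_part_Int_le assms) auto
qed auto

end
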